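(* Let $1\le d\le n-1$, let $K\subset\mathbb{R}^n$ be a (non-empty) polytope, possibly with empty interior, let $E\subseteq\mathbb{R}^n$ be a $d$-dimensional linear subspace, and let $u\in E^\perp$ satisfy $$u\notin\bigcup\{P_{E^\perp}N(K,F)\;:\;F\in\mathcal{F}(K)\setminus\{\emptyset\},\ \dim P_{E^\perp}N(K,F)\le n-d-1\}.$$ Let $$\tilde{\mathcal{F}}(K,E,u)=\{F\in\mathcal{F}(K)\setminus\{\emptyset\}\;:\;u\in P_{E^\perp}N(K,F)\},\qquad \tilde{\mathcal{F}}_d(K,E,u)=\tilde{\mathcal{F}}(K,E,u)\cap\mathcal{F}_d(K).$$ Then: (a) $\{P_E(\mathrm{relint}\,F)\;:\;F\in\tilde{\mathcal{F}}(K,E,u)\}$ is a family of pairwise disjoint sets (that is, $P_E(\mathrm{relint}\,F_1)\cap P_E(\mathrm{relint}\,F_2)=\emptyset$ for distinct $F_1,F_2\in\tilde{\mathcal{F}}(K,E,u)$); (b) $\bigcup\{P_EF\;:\;F\in\tilde{\mathcal{F}}(K,E,u)\}=P_EK$. Moreover, $\tilde{\mathcal{F}}(K,E,u)\subseteq\bigcup_{0\le j\le d}\mathcal{F}_j(K)$, and for each $F\in\tilde{\mathcal{F}}_d(K,E,u)$ the map $P_E|_F\colon F\to P_EF$ is an affine isomorphism.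
   Context: A polytope is the convex hull of a finite set of points. $P_V$ denotes the orthogonal projection onto a linear subspace $V$. The dimension of a convex set $A$ is the dimension of its affine hull $\mathrm{aff}\,A$, and $\mathrm{relint}\,A$ is its interior relative to $\mathrm{aff}\,A$. A face of a polytope $K$ is a convex subset $F\subseteq K$ such that $x,y\in K$ and $(x+y)/2\in F$ imply $x,y\in F$; $\mathcal{F}(K)$ is the set of all faces (including $\emptyset$ and $K$) and $\mathcal{F}_j(K)$ is the set of $j$-dimensional faces. For $x\in K$ the normal cone is $N(K,x)=\{v\in\mathbb{R}^n:\langle z-x,v\rangle\le0\ \ \forall z\in K\}$. For a non-empty face $F$, $N(K,F):=N(K,x)$ for any $x\in\mathrm{relint}\,F$ (this is independent of the choice of $x$). *)

theory Defs
  imports "HOL-Analysis.Analysis"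
begin
definition orth_proj :: "'a::euclidean_space set \<Rightarrow> 'a \<Rightarrow> 'a"
  where "orth_proj V x = (THE y. y \<in> V \<and> x - y \<in> V\<^sup>\<bottom>)"

lemma orth_proj_ex1:
  fixes V :: "'a::euclidean_space set"
  assumes "subspace V"
  shows "\<exists>!y. y \<in> V \<and> x - y \<in> V\<^sup>\<bottom>"
proof (rule ex_ex1I)
  obtain y z where "y \<in> span V" "\<And>w. w \<in> span V \<Longrightarrow> orthogonal z w" "x = y + z"
    using orthogonal_subspace_decomp_exists[of V x] by metis
  moreover have "span V = V" using assms by (simp add: span_eq_iff)
  ultimately show "\<exists>y. y \<in> V \<and> x - y \<in> V\<^sup>\<bottom>"
    by (auto simp: orthogonal_comp_def orthogonal_commute intro!: exI[of _ y])
next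
  fix y z
  assume y: "y \<in> V \<and> x - y \<in> V\<^sup>\<bottom>" and z: "z \<in> V \<and> x - z \<in> V\<^sup>\<bottom>"
  then have "y - z \<in> V" using assms by (simp add: subspace_diff)
  then have "(y - z) \<bullet> (x - z) = 0" "(y - z) \<bullet> (x - y) = 0"
    using y z by (auto simp: orthogonal_comp_def orthogonal_def)
  then have "(y - z) \<bullet> (y - z) = 0" by (simp add: inner_diff_right)
  then show "y = z" by simp
qed

lemma orth_proj_mem: "subspace V \<Longrightarrow> orth_proj V x \<in> V"
  and orth_proj_diff_mem: "subspace V \<Longrightarrow> x - orth_proj V x \<in> V\<^sup>\<bottom>"
  using theI'[OF orth_proj_ex1, of V x] by (auto simp: orth_proj_def)

definition faces :: "'a::euclidean_space set \<Rightarrow> 'a set set"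
  where "faces K = {F. F face_of K}"

definition faces_dim :: "nat \<Rightarrow> 'a::euclidean_space set \<Rightarrow> 'a set set"
  where "faces_dim j K = {F \<in> faces K. aff_dim F = int j}"

text \<open>The library predicate \<^const>\<open>face_of\<close> is phrased with open segments. For convex sets it agrees
  with the definition through midpoints.\<close>

lemma midpoint_face_aux:
  fixes K F :: "'a::euclidean_space set"
  assumes K: "convex K" and F: "F \<subseteq> K"
    and mid: "\<And>x y. x \<in> K \<Longrightarrow> y \<in> K \<Longrightarrow> (1/2) *\<^sub>R (x + y) \<in> F \<Longrightarrow> x \<in> F \<and> y \<in> F"
    and a: "a \<in> K" and b: "b \<in> K"
  shows "0 \<le> t \<Longrightarrow> t \<le> 1 - (1/2) ^ n \<Longrightarrow> (1 - t) *\<^sub>R a + t *\<^sub>R b \<in> F \<Longrightarrow> a \<in> F"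
proof (induction n arbitrary: t)
  case 0
  then show ?case by simp
next
  case (Suc n)
  have t1: "t < 1"
    using Suc.prems(2) zero_less_power[of "1/2::real" "Suc n"] by linarith
  show ?case
  proof (cases "t \<le> 1/2")
    case True
    have y: "(1 - 2 * t) *\<^sub>R a + (2 * t) *\<^sub>R b \<in> K"
      using K a b True Suc.prems(1) by (intro convexD) auto
    have "(1/2) *\<^sub>R (a + ((1 - 2 * t) *\<^sub>R a + (2 * t) *\<^sub>R b)) = (1 - t) *\<^sub>R a + t *\<^sub>R b"
    proof -
      have "(1/2 + (1 - 2 * t) / 2) *\<^sub>R a = (1 - t) *\<^sub>R a"
        by (rule arg_cong[where f = "\<lambda>r. r *\<^sub>R a"]) (simp add: field_simps)
      then show ?thesis
        by (simp add: scaleR_add_right scaleR_add_left)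
    qed
    then show ?thesis using mid[OF a y] Suc.prems(3) by simp
  next
    case False
    have y: "(1 - (2 * t - 1)) *\<^sub>R a + (2 * t - 1) *\<^sub>R b \<in> K"
      using K a b False t1 by (intro convexD) auto
    have "(1/2) *\<^sub>R (b + ((1 - (2 * t - 1)) *\<^sub>R a + (2 * t - 1) *\<^sub>R b)) = (1 - t) *\<^sub>R a + t *\<^sub>R b"
    proof -
      have half: "(1/2) *\<^sub>R (b + (c *\<^sub>R a + e *\<^sub>R b)) = (c / 2) *\<^sub>R a + (1/2 + e / 2) *\<^sub>R b" for c e
        by (simp add: scaleR_add_right scaleR_add_left)
      have "(1 - (2 * t - 1)) / 2 = 1 - t" "1/2 + (2 * t - 1) / 2 = t"
        by (simp_all add: field_simps)
      then show ?thesis by (simp only: half)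
    qed
    then have "(1 - (2 * t - 1)) *\<^sub>R a + (2 * t - 1) *\<^sub>R b \<in> F"
      using mid[OF b y] Suc.prems(3) by simp
    then show ?thesis
      using Suc.IH[of "2 * t - 1"] Suc.prems False by simp
  qed
qed

lemma face_of_iff_midpoint:
  fixes K :: "'a::euclidean_space set"
  assumes K: "convex K"
  shows "F face_of K \<longleftrightarrow>
    F \<subseteq> K \<and> convex F \<and> (\<forall>x\<in>K. \<forall>y\<in>K. (1/2) *\<^sub>R (x + y) \<in> F \<longrightarrow> x \<in> F \<and> y \<in> F)"
    (is "_ \<longleftrightarrow> ?R")
proof
  assume F: "F face_of K"
  have "x \<in> F \<and> y \<in> F" if "x \<in> K" "y \<in> K" "(1/2) *\<^sub>R (x + y) \<in> F" for x y
  proof (cases "x = y")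
    case True
    then show ?thesis using that by (simp flip: scaleR_2)
  next
    case False
    then have "midpoint x y \<in> open_segment x y" by simp
    then show ?thesis
      using F that by (auto simp: face_of_def midpoint_def inverse_eq_divide)
  qed
  then show ?R using F face_of_imp_subset face_of_imp_convex by blast
next
  assume R: ?R
  have *: "a \<in> F"
    if ab: "a \<in> K" "b \<in> K" and t: "0 < t" "t < 1" and x: "(1 - t) *\<^sub>R a + t *\<^sub>R b \<in> F"
    for a b :: 'a and t
  proof -
    obtain n where "(1/2::real) ^ n < 1 - t"
      using t real_arch_pow_inv[of "1 - t" "1/2"] by auto
    then show ?thesis
      using midpoint_face_aux[OF K _ _ ab, of F t n] R t x by auto
  qed
  have "a \<in> F \<and> b \<in> F"
    if ab: "a \<in> K" "b \<in> K" and x: "x \<in> F" "x \<in> open_segment a b" for a b x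
  proof -
    obtain t where t: "0 < t" "t < 1" "x = (1 - t) *\<^sub>R a + t *\<^sub>R b"
      using x by (auto simp: in_segment)
    have "x = (1 - (1 - t)) *\<^sub>R b + (1 - t) *\<^sub>R a" by (simp add: t)
    then show ?thesis
      using *[of a b t] *[of b a "1 - t"] ab t x by (simp add: add.commute)
  qed
  then show "F face_of K" using R unfolding face_of_def by meson
qed

definition normal_cone :: "'a::euclidean_space set \<Rightarrow> 'a \<Rightarrow> 'a set"
  where "normal_cone K x = {v. \<forall>z\<in>K. (z - x) \<bullet> v \<le> 0}"

text \<open>Independent of the chosen point, see \<open>normal_cone_face_eq\<close> below.\<close>

definition normal_cone_face :: "'a::euclidean_space set \<Rightarrow> 'a set \<Rightarrow> 'a set"
  where "normal_cone_face K F = normal_cone K (SOME x. x \<in> rel_interior F)"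

lemma normal_cone_rel_interior_subset:
  fixes K F :: "'a::euclidean_space set"
  assumes "convex F" "F \<subseteq> K" and x: "x \<in> rel_interior F" and y: "y \<in> rel_interior F"
  shows "normal_cone K x \<subseteq> normal_cone K y"
proof
  fix v assume v: "v \<in> normal_cone K x"
  have yF: "y \<in> F" using y rel_interior_subset by blast
  then obtain m where "m > 1" and m: "\<And>e. e > 1 \<and> e \<le> m \<Longrightarrow> (1 - e) *\<^sub>R y + e *\<^sub>R x \<in> F"
    using convex_rel_interior_if[OF \<open>convex F\<close> x] by (meson hull_inc)
  then have "(1 - m) *\<^sub>R y + m *\<^sub>R x \<in> K" using \<open>F \<subseteq> K\<close> by auto
  then have "((1 - m) *\<^sub>R y + m *\<^sub>R x - x) \<bullet> v \<le> 0" using v by (auto simp: normal_cone_def)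
  moreover have "(1 - m) *\<^sub>R y + m *\<^sub>R x - x = (m - 1) *\<^sub>R (x - y)" by (simp add: algebra_simps)
  ultimately have "x \<bullet> v \<le> y \<bullet> v"
    using \<open>m > 1\<close> by (simp add: mult_le_0_iff inner_diff_left)
  then show "v \<in> normal_cone K y"
    using v unfolding normal_cone_def by (force simp: inner_diff_left)
qed

lemma normal_cone_face_eq:
  fixes K F :: "'a::euclidean_space set"
  assumes "F \<in> faces K" and x: "x \<in> rel_interior F"
  shows "normal_cone_face K F = normal_cone K x"
proof -
  have F: "convex F" "F \<subseteq> K" using assms by (auto simp: faces_def face_of_def)
  have "(SOME x. x \<in> rel_interior F) \<in> rel_interior F" using x by (rule someI)
  then show ?thesis
    unfolding normal_cone_face_def using normal_cone_rel_interior_subset[OF F] x by blast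
qed

definition sel_faces :: "'a::euclidean_space set \<Rightarrow> 'a set \<Rightarrow> 'a \<Rightarrow> 'a set set"
  where "sel_faces K E u = {F \<in> faces K - {{}}. u \<in> orth_proj (E\<^sup>\<bottom>) ` normal_cone_face K F}"

definition sel_faces_dim :: "nat \<Rightarrow> 'a::euclidean_space set \<Rightarrow> 'a set \<Rightarrow> 'a \<Rightarrow> 'a set set"
  where "sel_faces_dim d K E u = sel_faces K E u \<inter> faces_dim d K"

text \<open>Intended for convex \<open>A\<close> only: the segment between two points of \<open>A\<close> should stay in \<open>A\<close>.\<close>

definition affine_map_on :: "'a::real_vector set \<Rightarrow> ('a \<Rightarrow> 'b::real_vector) \<Rightarrow> bool"
  where "affine_map_on A f \<longleftrightarrow>
    (\<forall>x\<in>A. \<forall>y\<in>A. \<forall>t\<in>{0..1}. f ((1 - t) *\<^sub>R x + t *\<^sub>R y) = (1 - t) *\<^sub>R f x + t *\<^sub>R f y)"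

definition affine_isomorphism_betw ::
    "('a::real_vector \<Rightarrow> 'b::real_vector) \<Rightarrow> 'a set \<Rightarrow> 'b set \<Rightarrow> bool"
  where "affine_isomorphism_betw f A B \<longleftrightarrow>
    bij_betw f A B \<and> affine_map_on A f \<and> affine_map_on B (the_inv_into A f)"

end

theory Submission
  imports Defs
begin

text \<open>A face \<open>F\<close> is selected iff for some \<open>w \<in> E\<close> the functional \<open>u + w\<close> attains its maximum over
  \<open>K\<close> at every point of \<open>F\<close>. Every \<open>s\<close> in the linear space parallel to \<open>F\<close> is orthogonal to
  \<open>N(K,F)\<close>, so a non-zero such \<open>s\<close> in the orthogonal complement of \<open>E\<close> would confine the projected
  normal cone to a hyperplane of that complement, which genericity of \<open>u\<close> forbids. Hence the
  projection onto \<open>E\<close> is injective on the affine hull of each selected face; this gives the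
  dimension bound and the affine isomorphism.

  For disjointness, if \<open>x\<^sub>1\<close>, \<open>x\<^sub>2\<close> lie in the relative interiors of selected faces and have the same
  projection, then \<open>u + w\<^sub>1\<close> is maximal at both points, so the face containing their midpoint in its
  relative interior is selected and contains both; injectivity yields \<open>x\<^sub>1 = x\<^sub>2\<close>. For the covering
  property, maximize \<open>u\<close> over a fibre of the projection of \<open>K\<close>; linear programming duality (here, a
  separation from a finitely generated cone) supplies the required \<open>w\<close> at a maximizer.\<close>

section \<open>Orthogonal projections as self-adjoint linear maps\<close>

lemma orth_proj_unique:
  fixes V :: "'a::euclidean_space set"
  assumes "subspace V" "y \<in> V" "x - y \<in> V\<^sup>\<bottom>"
  shows "orth_proj V x = y"
  using orth_proj_ex1[OF assms(1), of x] orth_proj_mem[OF assms(1), of x]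
    orth_proj_diff_mem[OF assms(1), of x] assms(2,3) by blast

lemma linear_orth_proj:
  fixes V :: "'a::euclidean_space set"
  assumes V: "subspace V"
  shows "linear (orth_proj V)"
proof
  fix x y :: 'a and c :: real
  note V' = subspace_orthogonal_comp[of V]
  have "x + y - (orth_proj V x + orth_proj V y) = (x - orth_proj V x) + (y - orth_proj V y)"
    by simp
  also have "\<dots> \<in> V\<^sup>\<bottom>"
    using V V' by (intro subspace_add orth_proj_diff_mem)
  finally show "orth_proj V (x + y) = orth_proj V x + orth_proj V y"
    using V by (intro orth_proj_unique subspace_add orth_proj_mem)
  have "c *\<^sub>R x - c *\<^sub>R orth_proj V x = c *\<^sub>R (x - orth_proj V x)"
    by (simp add: scaleR_diff_right)
  also have "\<dots> \<in> V\<^sup>\<bottom>"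
    using V V' by (intro subspace_scale orth_proj_diff_mem)
  finally show "orth_proj V (c *\<^sub>R x) = c *\<^sub>R orth_proj V x"
    using V by (intro orth_proj_unique subspace_scale orth_proj_mem)
qed

lemma orth_proj_eq_iff:
  fixes V :: "'a::euclidean_space set"
  assumes V: "subspace V"
  shows "orth_proj V x = y \<longleftrightarrow> y \<in> V \<and> x - y \<in> V\<^sup>\<bottom>"
  using orth_proj_unique[OF V] orth_proj_mem[OF V] orth_proj_diff_mem[OF V] by metis

lemma orth_proj_eq_orth_proj_iff:
  fixes V :: "'a::euclidean_space set"
  assumes V: "subspace V"
  shows "orth_proj V x = orth_proj V y \<longleftrightarrow> x - y \<in> V\<^sup>\<bottom>"
proof -
  have "orth_proj V x = orth_proj V y \<longleftrightarrow> orth_proj V (x - y) = 0"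
    by (simp add: linear_diff[OF linear_orth_proj[OF V]])
  then show ?thesis
    using V by (simp add: orth_proj_eq_iff subspace_0)
qed

lemma inner_orth_proj_left:
  fixes V :: "'a::euclidean_space set"
  assumes "subspace V" "a \<in> V"
  shows "orth_proj V x \<bullet> a = x \<bullet> a"
  using orth_proj_diff_mem[OF assms(1), of x] assms(2)
  by (auto simp: orthogonal_comp_def orthogonal_def inner_diff_right inner_commute)

lemma inner_orth_proj_commute:
  fixes V :: "'a::euclidean_space set"
  assumes "subspace V"
  shows "orth_proj V x \<bullet> a = x \<bullet> orth_proj V a"
  by (metis assms inner_commute inner_orth_proj_left orth_proj_mem)

section \<open>Faces, normal cones and the selection criterion\<close>

text \<open>A minimal face through \<open>x\<close> works: on its relative frontier,
  \<open>x\<close> would lie in a proper face of it, which is again a face of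
  \<open>K\<close>.\<close>

lemma polytope_point_in_rel_interior_face:
  fixes K :: "'a::euclidean_space set"
  assumes K: "polytope K" and x: "x \<in> K"
  obtains F where "F face_of K" "x \<in> rel_interior F"
proof -
  let ?A = "{F. F face_of K \<and> x \<in> F}"
  have "finite ?A"
    using finite_polytope_faces[OF K] by (rule rev_finite_subset) auto
  moreover have "K \<in> ?A"
    using K x by (simp add: face_of_refl polytope_imp_convex)
  ultimately obtain F where F: "F face_of K" "x \<in> F"
    and min: "\<And>G. G face_of K \<Longrightarrow> x \<in> G \<Longrightarrow> G \<subseteq> F \<Longrightarrow> F = G"
    using finite_has_minimal[of ?A] by auto
  have poly: "polyhedron F"
    using F(1) K face_of_polytope_polytope polytope_imp_polyhedron by blast
  have "x \<in> rel_interior F"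
  proof (rule ccontr)
    assume "x \<notin> rel_interior F"
    then have "x \<in> rel_frontier F"
      using F(2) closure_subset by (auto simp: rel_frontier_def)
    then obtain G where "G face_of F" "G \<noteq> F" "x \<in> G"
      using rel_frontier_of_polyhedron_alt[OF poly] by auto
    then show False
      using min F(1) face_of_trans face_of_imp_subset by blast
  qed
  then show thesis using F(1) that by blast
qed

text \<open>The maximizers of \<open>v\<close> over \<open>K\<close> form a face; if it contains one
  point of the relative interior of \<open>F\<close>, it contains all of \<open>F\<close>.\<close>

lemma normal_cone_face_iff:
  fixes K F :: "'a::euclidean_space set"
  assumes "convex K" and F: "F \<in> faces K - {{}}"
  shows "v \<in> normal_cone_face K F \<longleftrightarrow> (\<forall>x\<in>F. \<forall>z\<in>K. z \<bullet> v \<le> x \<bullet> v)"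
proof -
  have FK: "F \<subseteq> K" "convex F" "F \<noteq> {}"
    using F by (auto simp: faces_def face_of_def)
  then obtain x where x: "x \<in> rel_interior F"
    using rel_interior_eq_empty by blast
  then have xF: "x \<in> F" using rel_interior_subset by blast
  have N: "normal_cone_face K F = normal_cone K x"
    using normal_cone_face_eq F x by blast
  show ?thesis
  proof
    assume "v \<in> normal_cone_face K F"
    then have le: "z \<bullet> v \<le> x \<bullet> v" if "z \<in> K" for z
      using that by (auto simp: N normal_cone_def inner_diff_left)
    have "K \<inter> {z. v \<bullet> z = x \<bullet> v} face_of K"
      using le by (intro face_of_Int_supporting_hyperplane_le assms) (simp add: inner_commute)
    then have "F \<subseteq> K \<inter> {z. v \<bullet> z = x \<bullet> v}"
      by (rule subset_of_face_of) (use x xF FK in \<open>auto simp: inner_commute\<close>)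
    then show "\<forall>x\<in>F. \<forall>z\<in>K. z \<bullet> v \<le> x \<bullet> v"
      using le by (force simp: inner_commute)
  next
    assume "\<forall>x\<in>F. \<forall>z\<in>K. z \<bullet> v \<le> x \<bullet> v"
    then show "v \<in> normal_cone_face K F"
      using xF by (auto simp: N normal_cone_def inner_diff_left)
  qed
qed

lemma normal_cone_face_iff_point:
  fixes K F :: "'a::euclidean_space set"
  assumes "F \<in> faces K" and "x \<in> rel_interior F"
  shows "v \<in> normal_cone_face K F \<longleftrightarrow> (\<forall>z\<in>K. z \<bullet> v \<le> x \<bullet> v)"
  using normal_cone_face_eq[OF assms] by (auto simp: normal_cone_def inner_diff_left)

text \<open>Since the double complement of \<open>E\<close> is \<open>E\<close>, the vectors
  projecting to \<open>u\<close> are exactly those of \<open>u + E\<close>.\<close>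

lemma in_sel_faces_iff:
  fixes K E :: "'a::euclidean_space set"
  assumes "subspace E" "u \<in> E\<^sup>\<bottom>"
  shows "F \<in> sel_faces K E u \<longleftrightarrow>
    F \<in> faces K - {{}} \<and> (\<exists>w\<in>E. u + w \<in> normal_cone_face K F)"
proof -
  have "u = orth_proj (E\<^sup>\<bottom>) v \<longleftrightarrow> v - u \<in> E" for v
    using orth_proj_eq_iff[OF subspace_orthogonal_comp, of E v u] assms
    by (auto simp: orthogonal_comp_self)
  then have "u \<in> orth_proj (E\<^sup>\<bottom>) ` N \<longleftrightarrow> (\<exists>v\<in>N. v - u \<in> E)" for N
    by (simp add: image_iff)
  also have "(\<exists>v\<in>N. v - u \<in> E) \<longleftrightarrow> (\<exists>w\<in>E. u + w \<in> N)" for N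
    by (metis add_diff_cancel_left' diff_add_cancel add.commute)
  finally show ?thesis by (simp add: sel_faces_def)
qed

text \<open>Projecting along \<open>E\<close> preserves inner products with \<open>s\<close>, so the
  image lies in the part of the complement of \<open>E\<close> orthogonal to \<open>s\<close>. This
  part misses \<open>s\<close>, which costs one dimension.\<close>

lemma aff_dim_orth_proj_normals_le:
  fixes E N :: "'a::euclidean_space set"
  assumes E: "subspace E" and s: "s \<in> E\<^sup>\<bottom>" "s \<noteq> 0" and N: "\<And>v. v \<in> N \<Longrightarrow> s \<bullet> v = 0"
  shows "aff_dim (orth_proj (E\<^sup>\<bottom>) ` N) \<le> int DIM('a) - int (dim E) - 1"
proof -
  note E' = subspace_orthogonal_comp[of E]
  let ?T = "E\<^sup>\<bottom> \<inter> {y. s \<bullet> y = 0}"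
  have T: "subspace ?T"
    by (intro subspace_inter E' subspace_hyperplane)
  have "orth_proj (E\<^sup>\<bottom>) ` N \<subseteq> ?T"
    using N s inner_orth_proj_left[OF E' s(1)] orth_proj_mem[OF E'] by (auto simp: inner_commute)
  then have "aff_dim (orth_proj (E\<^sup>\<bottom>) ` N) \<le> int (dim ?T)"
    using aff_dim_subset aff_dim_subspace[OF T] by metis
  moreover have "s \<notin> ?T" using s(2) by simp
  then have "?T \<subset> E\<^sup>\<bottom>" using s(1) by blast
  then have "dim ?T < dim (E\<^sup>\<bottom>)"
    using dim_psubset[of ?T "E\<^sup>\<bottom>"] T E' by (simp add: span_eq_iff[THEN iffD2])
  moreover have "dim (E\<^sup>\<bottom>) + dim E = DIM('a)"
    using dim_subspace_orthogonal_to_vectors[OF E subspace_UNIV] by (simp add: orthogonal_comp_def)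
  ultimately show ?thesis by linarith
qed

text \<open>The vector \<open>a\<close> is a Lagrange multiplier for the constraint
  \<open>f y = f z\<close>. It comes from separating \<open>(0, 1)\<close> from the cone generated
  by all pairs \<open>(f (y - z), (y - z) \<bullet> u)\<close>.\<close>

lemma linear_maximizer_dual:
  fixes f :: "'a::euclidean_space \<Rightarrow> 'b::euclidean_space"
  assumes K: "polytope K" and f: "linear f" and z: "z \<in> K"
    and max: "\<And>y. y \<in> K \<Longrightarrow> f y = f z \<Longrightarrow> y \<bullet> u \<le> z \<bullet> u"
  obtains a where "\<And>y. y \<in> K \<Longrightarrow> y \<bullet> u + f y \<bullet> a \<le> z \<bullet> u + f z \<bullet> a"
proof -
  define L where "L y = (f y, y \<bullet> u)" for y
  have L: "linear L"
    unfolding L_def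
    by (rule linearI) (simp_all add: linear_add[OF f] linear_scale[OF f] inner_add_left)
  define C where "C = convex_cone hull (L ` ((\<lambda>y. y - z) ` K))"
  have "polytope ((\<lambda>y. y - z) ` K)"
    using polytope_translation_eq[of "- z" K] K by simp
  then have Q: "polytope (L ` ((\<lambda>y. y - z) ` K))"
    using L by (rule polytope_linear_image[rotated])
  have hull_Q: "convex hull (L ` ((\<lambda>y. y - z) ` K)) = L ` ((\<lambda>y. y - z) ` K)"
    using polytope_imp_convex[OF Q] by (rule hull_same)
  have nonempty: "L ` ((\<lambda>y. y - z) ` K) \<noteq> {}"
    using z by auto
  \<comment> \<open>The generators include \<open>0\<close>, so their compactness alone would not
    make the cone closed; polyhedrality does.\<close>
  have C: "convex C" "closed C"
    using polyhedron_convex_cone_hull_polytope[OF Q]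
    by (simp_all add: C_def polyhedron_imp_closed polyhedron_imp_convex)
  have LC: "c *\<^sub>R L (y - z) \<in> C" if "y \<in> K" "0 \<le> c" for y c
    unfolding C_def using that by (intro convex_cone_hull_mul hull_inc) auto
  \<comment> \<open>Otherwise some \<open>y\<close> in the fibre of \<open>z\<close> would have a
    larger inner product with \<open>u\<close>.\<close>
  have "(0, 1) \<notin> C"
  proof
    assume "(0, 1) \<in> C"
    then obtain c y where c: "0 \<le> c" and y: "y \<in> K" and eq: "(0, 1) = c *\<^sub>R L (y - z)"
      unfolding C_def convex_cone_hull_convex_hull_nonempty[OF nonempty] hull_Q by auto
    then have "c \<noteq> 0" "f (y - z) = 0" "c * ((y - z) \<bullet> u) = 1"
      by (auto simp: L_def)
    then have "f y = f z" and pos: "0 < c * ((y - z) \<bullet> u)"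
      by (simp_all add: linear_diff[OF f])
    then have "(y - z) \<bullet> u \<le> 0"
      using max y by (simp add: inner_diff_left)
    then show False
      using pos c mult_nonneg_nonpos[of c "(y - z) \<bullet> u"] by linarith
  qed
  then obtain p b where p: "p \<bullet> (0, 1) < b" and b: "\<And>q. q \<in> C \<Longrightarrow> b < p \<bullet> q"
    using separating_hyperplane_closed_point[OF C] by blast
  obtain a t where pt: "p = (a, t)" by (cases p)
  \<comment> \<open>The cone contains \<open>0\<close>. As \<open>p \<bullet> (0, 1)\<close> is
    \<open>t\<close>, it follows that \<open>t < b < 0\<close>.\<close>
  have b0: "b < 0"
    using b[OF LC[OF z, of 0]] by simp
  then have t: "t < 0" using p by (simp add: pt)
  \<comment> \<open>A linear functional bounded below on a cone is non-negative there.\<close>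
  have nonneg: "0 \<le> p \<bullet> L (y - z)" if y: "y \<in> K" for y
  proof (rule ccontr)
    assume neg: "\<not> 0 \<le> p \<bullet> L (y - z)"
    then have "b < p \<bullet> ((b / (p \<bullet> L (y - z))) *\<^sub>R L (y - z))"
      using b0 by (intro b LC y divide_nonpos_nonpos) auto
    then show False using neg by simp
  qed
  show thesis
  proof
    fix y assume "y \<in> K"
    from nonneg[OF this] have "f z \<bullet> a + t * (z \<bullet> u) \<le> f y \<bullet> a + t * (y \<bullet> u)"
      by (simp add: L_def pt linear_diff[OF f] inner_diff_left inner_diff_right inner_commute
          right_diff_distrib)
    \<comment> \<open>Dividing by the negative \<open>t\<close> reverses the inequality and gives
      \<open>u\<close> coefficient 1.\<close>
    then have "(f y \<bullet> a + t * (y \<bullet> u)) / t \<le> (f z \<bullet> a + t * (z \<bullet> u)) / t"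
      using t by (intro divide_right_mono_neg) auto
    then show "y \<bullet> u + f y \<bullet> (a /\<^sub>R t) \<le> z \<bullet> u + f z \<bullet> (a /\<^sub>R t)"
      using t by (simp add: add_divide_distrib) (simp add: divide_inverse_commute add.commute)
  qed
qed

section \<open>Selected faces for a generic direction\<close>

text \<open>Selection of \<open>F\<close> means that \<open>u\<close> lies in its projected normal
  cone, so \<open>generic\<close> is the contrapositive form of the avoidance condition on
  \<open>u\<close>.\<close>

locale generic_direction =
  fixes K E :: "'a::euclidean_space set" and u :: 'a
  assumes polytope: "polytope K" and subspace: "subspace E" and u: "u \<in> E\<^sup>\<bottom>"
    and generic: "\<And>F. F \<in> sel_faces K E u \<Longrightarrow>
      int DIM('a) - int (dim E) - 1 < aff_dim (orth_proj (E\<^sup>\<bottom>) ` normal_cone_face K F)"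
begin

lemma convex_K: "convex K"
  using polytope by (rule polytope_imp_convex)

text \<open>Every normal is constant on \<open>F\<close>, hence vanishes on the span of its
  differences. Injectivity is needed on this whole span for the projection to preserve its
  dimension.\<close>

lemma inj_on_span_sel_face:
  assumes F: "F \<in> sel_faces K E u" and a: "a \<in> F"
  shows "inj_on (orth_proj E) (span ((\<lambda>x. x - a) ` F))"
proof -
  have F': "F \<in> faces K - {{}}" using F by (auto simp: sel_faces_def)
  then have FK: "F \<subseteq> K" by (auto simp: faces_def face_of_def)
  have orth: "s \<bullet> v = 0"
    if v: "v \<in> normal_cone_face K F" and s: "s \<in> span ((\<lambda>x. x - a) ` F)" for s v
  proof -
    have le: "z \<bullet> v \<le> x \<bullet> v" if "x \<in> F" "z \<in> K" for x z
      using v that by (simp add: normal_cone_face_iff[OF convex_K F'])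
    have "x \<bullet> v = a \<bullet> v" if "x \<in> F" for x
      using le[OF that, of a] le[OF a, of x] a that FK by (intro antisym) auto
    then have "(\<lambda>x. x - a) ` F \<subseteq> {y. v \<bullet> y = 0}"
      by (auto simp: inner_diff_right inner_commute)
    then have "span ((\<lambda>x. x - a) ` F) \<subseteq> {y. v \<bullet> y = 0}"
      using subspace_hyperplane by (rule span_minimal)
    then show ?thesis using s by (auto simp: inner_commute)
  qed
  show ?thesis
  proof (rule inj_onI)
    fix x y
    assume *: "x \<in> span ((\<lambda>x. x - a) ` F)" "y \<in> span ((\<lambda>x. x - a) ` F)"
      and eq: "orth_proj E x = orth_proj E y"
    have "x - y \<in> E\<^sup>\<bottom>"
      using eq by (simp add: orth_proj_eq_orth_proj_iff[OF subspace])
    moreover have "(x - y) \<bullet> v = 0" if "v \<in> normal_cone_face K F" for v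
      using orth[OF that span_diff[OF *]] .
    \<comment> \<open>A non-zero \<open>x - y\<close> would serve as the vector \<open>s\<close>
      that bounds the dimension of the projected cone, against \<open>generic\<close>.\<close>
    ultimately have "x - y = 0"
      using aff_dim_orth_proj_normals_le[OF subspace, of "x - y" "normal_cone_face K F"]
        generic[OF F] by (meson linorder_not_less)
    then show "x = y" by simp
  qed
qed

lemma inj_on_sel_face:
  assumes F: "F \<in> sel_faces K E u"
  shows "inj_on (orth_proj E) F"
proof (rule inj_onI)
  fix x y assume xy: "x \<in> F" "y \<in> F" and eq: "orth_proj E x = orth_proj E y"
  have "orth_proj E (x - y) = orth_proj E (y - y)"
    using eq by (simp add: linear_diff[OF linear_orth_proj[OF subspace]]
        linear_0[OF linear_orth_proj[OF subspace]])
  then have "x - y = y - y"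
    by (rule inj_onD[OF inj_on_span_sel_face[OF F xy(2)]]) (use xy in \<open>auto intro!: span_base\<close>)
  then show "x = y" by simp
qed

lemma aff_dim_sel_face_le:
  assumes F: "F \<in> sel_faces K E u"
  shows "aff_dim F \<le> int (dim E)"
proof -
  obtain a where a: "a \<in> F" using F by (auto simp: sel_faces_def)
  let ?S = "(\<lambda>x. x - a) ` F"
  have "aff_dim F = int (dim ?S)"
    using a by (intro aff_dim_eq_dim_subtract hull_inc)
  also have "dim ?S = dim (orth_proj E ` ?S)"
    using dim_image_eq[OF linear_orth_proj[OF subspace] inj_on_span_sel_face[OF F a]] by simp
  also have "\<dots> \<le> dim E"
    using orth_proj_mem[OF subspace] by (intro dim_subset) auto
  finally show ?thesis by simp
qed

lemma sel_faces_eq: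
  assumes F: "F \<in> sel_faces K E u" and G: "G \<in> sel_faces K E u"
    and x: "x \<in> rel_interior F" and y: "y \<in> rel_interior G"
    and eq: "orth_proj E x = orth_proj E y"
  shows "F = G"
proof -
  have F': "F \<in> faces K" and G': "G \<in> faces K"
    using F G by (auto simp: sel_faces_def)
  have xK: "x \<in> K" and yK: "y \<in> K"
    using F' G' x y rel_interior_subset by (auto simp: faces_def dest!: face_of_imp_subset)
  obtain v where v: "v \<in> E" "\<And>z. z \<in> K \<Longrightarrow> z \<bullet> (u + v) \<le> x \<bullet> (u + v)"
    using F by (auto simp: in_sel_faces_iff[OF subspace u] normal_cone_face_iff_point[OF F' x])
  obtain w where w: "w \<in> E" "\<And>z. z \<in> K \<Longrightarrow> z \<bullet> (u + w) \<le> y \<bullet> (u + w)"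
    using G by (auto simp: in_sel_faces_iff[OF subspace u] normal_cone_face_iff_point[OF G' y])
  have "x - y \<in> E\<^sup>\<bottom>"
    using eq by (simp add: orth_proj_eq_orth_proj_iff[OF subspace])
  then have E_eq: "x \<bullet> e = y \<bullet> e" if "e \<in> E" for e
    using that by (auto simp: orthogonal_comp_def orthogonal_def inner_diff_right inner_commute)
  \<comment> \<open>Elements of \<open>E\<close> do not distinguish \<open>x\<close> from
    \<open>y\<close>, so the two maximality conditions give
    \<open>x \<bullet> u = y \<bullet> u\<close>.\<close>
  have xy: "x \<bullet> (u + v) = y \<bullet> (u + v)"
    using v(2)[OF yK] w(2)[OF xK] E_eq[OF v(1)] E_eq[OF w(1)] by (simp add: inner_add_right)
  define m where "m = midpoint x y"
  have "m \<bullet> (u + v) = (x \<bullet> (u + v) + y \<bullet> (u + v)) / 2"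
    by (simp only: m_def midpoint_def inner_scaleR_left inner_add_left) simp
  with xy have m: "m \<bullet> (u + v) = x \<bullet> (u + v)" by simp
  have "m \<in> K"
    using closed_segment_subset[OF xK yK convex_K] by (auto simp: m_def)
  then obtain H where H: "H face_of K" "m \<in> rel_interior H"
    using polytope_point_in_rel_interior_face[OF polytope] by blast
  have mH: "m \<in> H" using H(2) rel_interior_subset by blast
  have H': "H \<in> faces K" using H(1) by (simp add: faces_def)
  have "u + v \<in> normal_cone_face K H"
    using v(2) by (simp add: normal_cone_face_iff_point[OF H' H(2)] m)
  then have selH: "H \<in> sel_faces K E u"
    using v(1) mH H' by (auto simp: in_sel_faces_iff[OF subspace u])
  have "x \<in> H \<and> y \<in> H"
    using H(1) mH xK yK
    by (auto simp: face_of_iff_midpoint[OF convex_K] m_def midpoint_def inverse_eq_divide)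
  then have "x = y"
    using inj_on_sel_face[OF selH] eq by (auto dest: inj_onD)
  \<comment> \<open>Faces whose relative interiors share a point coincide.\<close>
  then show "F = G"
    using face_of_eq F' G' x y by (auto simp: faces_def)
qed

lemma sel_faces_cover:
  assumes x: "x \<in> K"
  obtains F z where "F \<in> sel_faces K E u" "z \<in> F" "orth_proj E z = orth_proj E x"
proof -
  note lin = linear_orth_proj[OF subspace]
  let ?S = "K \<inter> {z. orth_proj E z = orth_proj E x}"
  have "closed {z. orth_proj E z = orth_proj E x}"
    using lin by (intro closed_Collect_eq linear_continuous_on continuous_on_const)
      (simp add: linear_conv_bounded_linear)
  then have S: "compact ?S"
    using polytope_imp_compact[OF polytope] by (rule compact_Int_closed[rotated])
  have "?S \<noteq> {}" using x by auto
  moreover have "continuous_on ?S (\<lambda>y. y \<bullet> u)"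
    by (intro continuous_on_inner continuous_on_id continuous_on_const)
  ultimately have "\<exists>z\<in>?S. \<forall>y\<in>?S. y \<bullet> u \<le> z \<bullet> u"
    by (rule continuous_attains_sup[OF S])
  then obtain z where z: "z \<in> ?S" and max: "\<And>y. y \<in> ?S \<Longrightarrow> y \<bullet> u \<le> z \<bullet> u"
    by meson
  have zK: "z \<in> K" and zx: "orth_proj E z = orth_proj E x" using z by auto
  obtain a where a: "y \<bullet> u + orth_proj E y \<bullet> a \<le> z \<bullet> u + orth_proj E z \<bullet> a" if "y \<in> K" for y
    using linear_maximizer_dual[OF polytope lin zK, of u] max zx by auto
  obtain F where F: "F face_of K" "z \<in> rel_interior F"
    using polytope_point_in_rel_interior_face[OF polytope zK] by blast
  have zF: "z \<in> F" using F(2) rel_interior_subset by blast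
  have F': "F \<in> faces K" using F(1) by (simp add: faces_def)
  \<comment> \<open>The multiplier \<open>a\<close> need not lie in \<open>E\<close>;
    self-adjointness moves the projection from \<open>y\<close> onto \<open>a\<close>.\<close>
  have "u + orth_proj E a \<in> normal_cone_face K F"
    using a by (simp add: normal_cone_face_iff_point[OF F' F(2)] inner_add_right
        inner_orth_proj_commute[OF subspace])
  then have "F \<in> sel_faces K E u"
    using F' zF orth_proj_mem[OF subspace] by (auto simp: in_sel_faces_iff[OF subspace u])
  then show thesis using zF zx that by blast
qed

end

section \<open>Affine isomorphisms and the final assembly\<close>

text \<open>Convexity keeps the combination of preimages in \<open>A\<close>, where the inverse can
  recover it from its image.\<close>

lemma affine_isomorphism_betw_linear:
  assumes f: "linear f" and A: "convex A" and inj: "inj_on f A"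
  shows "affine_isomorphism_betw f A (f ` A)"
proof -
  have comb: "f ((1 - t) *\<^sub>R x + t *\<^sub>R y) = (1 - t) *\<^sub>R f x + t *\<^sub>R f y" for x y t
    by (simp add: linear_add[OF f] linear_scale[OF f])
  have "the_inv_into A f ((1 - t) *\<^sub>R f x + t *\<^sub>R f y) = (1 - t) *\<^sub>R x + t *\<^sub>R y"
    if "x \<in> A" "y \<in> A" "t \<in> {0..1}" for x y t
    using the_inv_into_f_f[OF inj, of "(1 - t) *\<^sub>R x + t *\<^sub>R y"] that
    by (simp add: comb convexD[OF A])
  then show ?thesis
    using inj by (auto simp: affine_isomorphism_betw_def affine_map_on_def bij_betw_def comb
        the_inv_into_f_f)
qed

theorem proposition2p1:
  fixes K E :: "'a::euclidean_space set" and u :: 'a and d :: nat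
  assumes "1 \<le> d" and "d \<le> DIM('a) - 1"
    and "polytope K" and "K \<noteq> {}"
    and "subspace E" and "dim E = d"
    and "u \<in> E\<^sup>\<bottom>"
    and "u \<notin> \<Union> {orth_proj (E\<^sup>\<bottom>) ` normal_cone_face K F | F.
              F \<in> faces K - {{}} \<and>
              aff_dim (orth_proj (E\<^sup>\<bottom>) ` normal_cone_face K F) \<le> int DIM('a) - int d - 1}"
  shows "disjoint_family_on (\<lambda>F. orth_proj E ` rel_interior F) (sel_faces K E u) \<and>
    \<Union> {orth_proj E ` F | F. F \<in> sel_faces K E u} = orth_proj E ` K \<and>
    sel_faces K E u \<subseteq> (\<Union>j\<in>{0..d}. faces_dim j K) \<and>
    (\<forall>F \<in> sel_faces_dim d K E u. affine_isomorphism_betw (orth_proj E) F (orth_proj E ` F))"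
proof -
  interpret generic_direction K E u
  proof
    fix F assume F: "F \<in> sel_faces K E u"
    show "int DIM('a) - int (dim E) - 1 < aff_dim (orth_proj (E\<^sup>\<bottom>) ` normal_cone_face K F)"
    proof (rule ccontr)
      assume "\<not> ?thesis"
      then show False
        using F assms(6,8) unfolding sel_faces_def not_less by blast
    qed
  qed (use assms in auto)
  have sel: "F \<subseteq> K" "convex F" "F \<noteq> {}" "F \<in> faces K" if "F \<in> sel_faces K E u" for F
    using that by (auto simp: sel_faces_def faces_def face_of_def)
  have "disjoint_family_on (\<lambda>F. orth_proj E ` rel_interior F) (sel_faces K E u)"
    using sel_faces_eq by (fastforce simp: disjoint_family_on_def)
  moreover have "\<Union> {orth_proj E ` F | F. F \<in> sel_faces K E u} = orth_proj E ` K"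
  proof
    show "\<Union> {orth_proj E ` F | F. F \<in> sel_faces K E u} \<subseteq> orth_proj E ` K"
      using sel(1) by blast
    show "orth_proj E ` K \<subseteq> \<Union> {orth_proj E ` F | F. F \<in> sel_faces K E u}"
    proof
      fix p assume "p \<in> orth_proj E ` K"
      then obtain x where x: "x \<in> K" "p = orth_proj E x" by blast
      obtain F z where "F \<in> sel_faces K E u" "z \<in> F" "orth_proj E z = orth_proj E x"
        using sel_faces_cover[OF x(1)] .
      then show "p \<in> \<Union> {orth_proj E ` F | F. F \<in> sel_faces K E u}"
        using x(2) by (intro UnionI[of "orth_proj E ` F"]) (auto intro: rev_image_eqI)
    qed
  qed
  moreover have "sel_faces K E u \<subseteq> (\<Union>j\<in>{0..d}. faces_dim j K)"
  proof
    fix F assume F: "F \<in> sel_faces K E u"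
    \<comment> \<open>Excluding the empty face, of dimension -1, makes
      \<open>nat (aff_dim F)\<close> a faithful index.\<close>
    have "0 \<le> aff_dim F"
      using sel(3)[OF F] aff_dim_geq[of F] aff_dim_empty[of F] by linarith
    then show "F \<in> (\<Union>j\<in>{0..d}. faces_dim j K)"
      using aff_dim_sel_face_le[OF F] sel(4)[OF F] assms(6)
      by (intro UN_I[of "nat (aff_dim F)"]) (auto simp: faces_dim_def)
  qed
  moreover have "affine_isomorphism_betw (orth_proj E) F (orth_proj E ` F)"
    if "F \<in> sel_faces_dim d K E u" for F
    using that sel inj_on_sel_face linear_orth_proj[OF subspace]
    by (intro affine_isomorphism_betw_linear) (auto simp: sel_faces_dim_def)
  ultimately show ?thesis by blast
qed

end
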